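(* Let $n=3$ and consider a joint profile for $3$ men and $3$ women with key function $f$. Then all stable matchings are uniform. Moreover: (1) If $f(1)=1$, there is exactly one stable matching, namely the one in which all couples have mutual ranking $(1,1)$. (2) If $f(i)=4-i$ for $i=1,2,3$, there are exactly three stable matchings: the uniform matchings corresponding to mutual rankings $(1,3)$, $(2,2)$ and $(3,1)$. (3) For each of the remaining three bijections $f:\{1,2,3\}\to\{1,2,3\}$, there are exactly two stable matchings: the uniform matching corresponding to mutual ranking $(1,f(1))$, which is woman-optimal and man-pessimal, and the uniform matching corresponding to mutual ranking $(f^{-1}(1),1)$, which is man-optimal and woman-pessimal.
   Context: A preference profile for $n$ men and $n$ women consists of a strict ranking (without ties) by each man of all $n$ women and by each woman of all $n$ men, with ranks $1,\dots,n$, where $1$ is the most preferred. For woman $w$ and man $m$, their mutual ranking is the pair $(s,t)$, where $s$ is the rank that $w$ gives to $m$ and $t$ is the rank that $m$ gives to $w$. A profile is called joint if there is a function $f:\{1,\dots,n\}\to\{1,\dots,n\}$, called the key, such that whenever a woman ranks a man as $i$, he ranks her as $f(i)$. The key of a joint profile is always a bijection. A matching is a perfect matching of men with women. A blocking pair for a matching is a man and a woman who are not matched to each other and who each prefer the other to their assigned partner. A matching is stable if it has no blocking pair. A matching in a joint profile is called uniform, corresponding to mutual ranking $(i,j)$, if every couple in it has mutual ranking $(i,j)$; for each $i$ there is exactly one uniform matching corresponding to $(i,f(i))$. A valid partner of a person is someone they are matched with in some stable matching. A stable matching is man-optimal (man-pessimal) if each man is matched with his best (worst) valid partner; woman-optimal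 and woman-pessimal are defined analogously. *)

theory Defs
  imports Main
begin

record ('m, 'w) profile =
  men :: "'m set"
  women :: "'w set"
  mrank :: "'m \<Rightarrow> 'w \<Rightarrow> nat"
  wrank :: "'w \<Rightarrow> 'm \<Rightarrow> nat"

definition preference_profile :: "nat \<Rightarrow> ('m, 'w) profile \<Rightarrow> bool" where
  "preference_profile n P \<longleftrightarrow>
     finite (men P) \<and> card (men P) = n \<and> finite (women P) \<and> card (women P) = n \<and>
     (\<forall>m\<in>men P. bij_betw (mrank P m) (women P) {1..n}) \<and>
     (\<forall>w\<in>women P. bij_betw (wrank P w) (men P) {1..n})"

(* The first component is the rank given by the woman, the second the rank given by the man. *)
definition mutual_ranking :: "('m, 'w) profile \<Rightarrow> 'w \<Rightarrow> 'm \<Rightarrow> nat \<times> nat" where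
  "mutual_ranking P w m = (wrank P w m, mrank P m w)"

(* Only the values of the key on {1..n} matter; that it permutes {1..n} is not assumed. *)
definition joint_with_key :: "nat \<Rightarrow> ('m, 'w) profile \<Rightarrow> (nat \<Rightarrow> nat) \<Rightarrow> bool" where
  "joint_with_key n P f \<longleftrightarrow>
     preference_profile n P \<and> (\<forall>i\<in>{1..n}. f i \<in> {1..n}) \<and>
     (\<forall>w\<in>women P. \<forall>m\<in>men P. \<forall>i\<in>{1..n}. wrank P w m = i \<longrightarrow> mrank P m w = f i)"

(* A matching is its set of couples (man, woman), so that counting matchings by set equality
   involves no junk values outside the men and women of the profile. *)
definition matching :: "('m, 'w) profile \<Rightarrow> ('m \<times> 'w) set \<Rightarrow> bool" where
  "matching P \<mu> \<longleftrightarrow>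
     \<mu> \<subseteq> men P \<times> women P \<and>
     (\<forall>m\<in>men P. \<exists>!w. (m, w) \<in> \<mu>) \<and> (\<forall>w\<in>women P. \<exists>!m. (m, w) \<in> \<mu>)"

definition blocking_pair :: "('m, 'w) profile \<Rightarrow> ('m \<times> 'w) set \<Rightarrow> 'm \<Rightarrow> 'w \<Rightarrow> bool" where
  "blocking_pair P \<mu> m w \<longleftrightarrow>
     m \<in> men P \<and> w \<in> women P \<and> (m, w) \<notin> \<mu> \<and>
     (\<exists>w'. (m, w') \<in> \<mu> \<and> mrank P m w < mrank P m w') \<and>
     (\<exists>m'. (m', w) \<in> \<mu> \<and> wrank P w m < wrank P w m')"

definition stable_matching :: "('m, 'w) profile \<Rightarrow> ('m \<times> 'w) set \<Rightarrow> bool" where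
  "stable_matching P \<mu> \<longleftrightarrow> matching P \<mu> \<and> \<not> (\<exists>m w. blocking_pair P \<mu> m w)"

definition uniform_matching_for ::
    "('m, 'w) profile \<Rightarrow> nat \<times> nat \<Rightarrow> ('m \<times> 'w) set \<Rightarrow> bool" where
  "uniform_matching_for P r \<mu> \<longleftrightarrow>
     matching P \<mu> \<and> (\<forall>(m, w)\<in>\<mu>. mutual_ranking P w m = r)"

definition uniform_matching :: "('m, 'w) profile \<Rightarrow> ('m \<times> 'w) set \<Rightarrow> bool" where
  "uniform_matching P \<mu> \<longleftrightarrow> (\<exists>r. uniform_matching_for P r \<mu>)"

definition valid_partners :: "('m, 'w) profile \<Rightarrow> 'm \<Rightarrow> 'w \<Rightarrow> bool" where
  "valid_partners P m w \<longleftrightarrow> (\<exists>\<mu>. stable_matching P \<mu> \<and> (m, w) \<in> \<mu>)"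

definition man_optimal :: "('m, 'w) profile \<Rightarrow> ('m \<times> 'w) set \<Rightarrow> bool" where
  "man_optimal P \<mu> \<longleftrightarrow> stable_matching P \<mu> \<and>
     (\<forall>(m, w)\<in>\<mu>. \<forall>w'. valid_partners P m w' \<longrightarrow> mrank P m w \<le> mrank P m w')"

definition man_pessimal :: "('m, 'w) profile \<Rightarrow> ('m \<times> 'w) set \<Rightarrow> bool" where
  "man_pessimal P \<mu> \<longleftrightarrow> stable_matching P \<mu> \<and>
     (\<forall>(m, w)\<in>\<mu>. \<forall>w'. valid_partners P m w' \<longrightarrow> mrank P m w' \<le> mrank P m w)"

definition woman_optimal :: "('m, 'w) profile \<Rightarrow> ('m \<times> 'w) set \<Rightarrow> bool" where
  "woman_optimal P \<mu> \<longleftrightarrow> stable_matching P \<mu> \<and>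
     (\<forall>(m, w)\<in>\<mu>. \<forall>m'. valid_partners P m' w \<longrightarrow> wrank P w m \<le> wrank P w m')"

definition woman_pessimal :: "('m, 'w) profile \<Rightarrow> ('m \<times> 'w) set \<Rightarrow> bool" where
  "woman_pessimal P \<mu> \<longleftrightarrow> stable_matching P \<mu> \<and>
     (\<forall>(m, w)\<in>\<mu>. \<forall>m'. valid_partners P m' w \<longrightarrow> wrank P w m' \<le> wrank P w m)"

end

theory Submission
  imports Defs
begin

text \<open>
  Write $L(m,w)$ for the rank that woman $w$ gives to man $m$.  In a joint profile $L$ is a Latin
  square: a woman uses every rank once, and since the key turns the ranks that a man receives into
  the ranks that he gives, he cannot receive one rank from two women.  The uniform matchings are the
  symbol classes of this square.

  A pair with symbol $j$ blocks the class of $i$ exactly if $j < i$ and $f(j) < f(i)$, and each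
  symbol does occur.  So the class of $i$ is stable exactly if $f(i) < f(j)$ for all $j < i$, that
  is, if $i$ is a left-to-right minimum of the key (lemma
  \<open>stable_rank_class_iff_left_to_right_minimum\<close>).  This much holds for every $n$.

  What is special about $n = 3$ is that a matching with couples of two different symbols contains
  all three symbols (lemma \<open>nonuniform_three_matching_has_all_ranks\<close>), as a Latin square of order
  $3$ is the Cayley table of $\mathbb{Z}/3$ up to renaming.  The man of the couple with symbol $a$
  and the woman of the couple with symbol $b$ then form a pair with the third symbol $c$, which
  blocks if $c < b$ and $f(c) < f(a)$.  Every key admits such a choice of $a, b, c$, so stable
  matchings are uniform, and the three cases of the theorem list the left-to-right minima of the
  six permutations of $\{1,2,3\}$.
\<close>

section \<open>Joint profiles as Latin squares\<close>

lemma joint_profile_facts: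
  assumes "joint_with_key n P f"
  shows finite_men: "finite (men P)" and card_men: "card (men P) = n"
    and finite_women: "finite (women P)" and card_women: "card (women P) = n"
    and mrank_bij: "\<And>m. m \<in> men P \<Longrightarrow> bij_betw (mrank P m) (women P) {1..n}"
    and wrank_bij: "\<And>w. w \<in> women P \<Longrightarrow> bij_betw (wrank P w) (men P) {1..n}"
    and key_range: "\<And>i. i \<in> {1..n} \<Longrightarrow> f i \<in> {1..n}"
  using assms by (auto simp: joint_with_key_def preference_profile_def)

lemma wrank_range:
  assumes "joint_with_key n P f" "m \<in> men P" "w \<in> women P"
  shows "wrank P w m \<in> {1..n}"
  using wrank_bij[OF assms(1,3)] assms(2) by (auto simp: bij_betw_def)

lemma mrank_range:
  assumes "joint_with_key n P f" "m \<in> men P" "w \<in> women P"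
  shows "mrank P m w \<in> {1..n}"
  using mrank_bij[OF assms(1,2)] assms(3) by (auto simp: bij_betw_def)

lemma mrank_eq_key_wrank:
  assumes "joint_with_key n P f" "m \<in> men P" "w \<in> women P"
  shows "mrank P m w = f (wrank P w m)"
  using assms wrank_range[OF assms] by (auto simp: joint_with_key_def)

text \<open>A man gives every rank to somebody, and each rank that he gives is a value of the key.\<close>

lemma key_bij:
  assumes J: "joint_with_key n P f"
  shows "bij_betw f {1..n} {1..n}"
proof (cases "men P = {}")
  case True
  then show ?thesis using card_men[OF J] by (auto simp: bij_betw_def)
next
  case False
  then obtain m where m: "m \<in> men P" by auto
  have "{1..n} = mrank P m ` women P"
    using mrank_bij[OF J m] by (auto simp: bij_betw_def)
  also have "\<dots> \<subseteq> f ` {1..n}"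
    using mrank_eq_key_wrank[OF J m] wrank_range[OF J m] by auto
  finally have "f ` {1..n} = {1..n}" using key_range[OF J] by auto
  then show ?thesis
    by (simp add: bij_betw_def eq_card_imp_inj_on)
qed

lemma key_eq_iff:
  assumes "joint_with_key n P f" "i \<in> {1..n}" "j \<in> {1..n}"
  shows "f i = f j \<longleftrightarrow> i = j"
  using inj_on_eq_iff[OF bij_betw_imp_inj_on[OF key_bij[OF assms(1)]] assms(2,3)] .

lemma wrank_inj_men:
  assumes "joint_with_key n P f" "w \<in> women P" "m \<in> men P" "m' \<in> men P" "m \<noteq> m'"
  shows "wrank P w m \<noteq> wrank P w m'"
  using wrank_bij[OF assms(1,2)] assms(3-) by (auto simp: bij_betw_def inj_on_def)

text \<open>Two women who gave a man the same rank would get the same rank from him, by the key.\<close>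

lemma wrank_inj_women:
  assumes J: "joint_with_key n P f" and m: "m \<in> men P"
    and w: "w \<in> women P" "w' \<in> women P" "w \<noteq> w'"
  shows "wrank P w m \<noteq> wrank P w' m"
proof
  assume "wrank P w m = wrank P w' m"
  then have "mrank P m w = mrank P m w'"
    using mrank_eq_key_wrank[OF J m] w by simp
  then show False
    using mrank_bij[OF J m] w by (auto simp: bij_betw_def inj_on_def)
qed

lemma ex_man_of_rank:
  assumes "joint_with_key n P f" "w \<in> women P" "i \<in> {1..n}"
  shows "\<exists>m\<in>men P. wrank P w m = i"
  using wrank_bij[OF assms(1,2)] assms(3) by (metis bij_betw_iff_bijections)

lemma ex_woman_of_rank:
  assumes J: "joint_with_key n P f" and m: "m \<in> men P" and i: "i \<in> {1..n}"
  shows "\<exists>w\<in>women P. wrank P w m = i"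
proof -
  obtain w where w: "w \<in> women P" "mrank P m w = f i"
    using mrank_bij[OF J m] key_range[OF J i] by (metis bij_betw_iff_bijections)
  have "wrank P w m = i"
    using key_eq_iff[OF J wrank_range[OF J m w(1)] i] mrank_eq_key_wrank[OF J m w(1)] w(2) by simp
  with w show ?thesis by blast
qed

section \<open>Uniform matchings and left-to-right minima of the key\<close>

definition rank_class :: "('m, 'w) profile \<Rightarrow> nat \<Rightarrow> ('m \<times> 'w) set" where
  "rank_class P i = {(m, w). m \<in> men P \<and> w \<in> women P \<and> wrank P w m = i}"

definition left_to_right_minima :: "nat \<Rightarrow> (nat \<Rightarrow> nat) \<Rightarrow> nat set" where
  "left_to_right_minima n f = {i\<in>{1..n}. \<forall>j\<in>{1..n}. j < i \<longrightarrow> f i < f j}"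

lemma matching_rank_class:
  assumes J: "joint_with_key n P f" and i: "i \<in> {1..n}"
  shows "matching P (rank_class P i)"
  unfolding matching_def
proof (intro conjI ballI)
  show "rank_class P i \<subseteq> men P \<times> women P" by (auto simp: rank_class_def)
next
  fix m assume m: "m \<in> men P"
  show "\<exists>!w. (m, w) \<in> rank_class P i"
    using ex_woman_of_rank[OF J m i] wrank_inj_women[OF J m] m
    unfolding rank_class_def by blast
next
  fix w assume w: "w \<in> women P"
  show "\<exists>!m. (m, w) \<in> rank_class P i"
    using ex_man_of_rank[OF J w i] wrank_inj_men[OF J w] w
    unfolding rank_class_def by blast
qed

lemma uniform_rank_class:
  assumes J: "joint_with_key n P f" and i: "i \<in> {1..n}"
  shows "uniform_matching_for P (i, f i) (rank_class P i)"
  using matching_rank_class[OF J i] mrank_eq_key_wrank[OF J]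
  by (auto simp: uniform_matching_for_def mutual_ranking_def rank_class_def)

lemma rank_class_inj:
  assumes J: "joint_with_key n P f" and n: "n \<ge> 1"
  shows "inj_on (rank_class P) {1..n}"
proof (rule inj_onI)
  fix i j assume i: "i \<in> {1..n}" and "j \<in> {1..n}" and eq: "rank_class P i = rank_class P j"
  obtain w where w: "w \<in> women P" using card_women[OF J] n by fastforce
  obtain m where "m \<in> men P" "wrank P w m = i" using ex_man_of_rank[OF J w i] by auto
  then have "(m, w) \<in> rank_class P j" using w unfolding eq[symmetric] by (simp add: rank_class_def)
  with \<open>wrank P w m = i\<close> show "i = j" by (simp add: rank_class_def)
qed

lemma matching_couple:
  assumes "matching P \<mu>" "(m, w) \<in> \<mu>"
  shows "m \<in> men P" "w \<in> women P"
  using assms by (auto simp: matching_def)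

lemma matching_ex_woman:
  assumes "matching P \<mu>" "m \<in> men P"
  shows "\<exists>w. (m, w) \<in> \<mu>"
  using assms by (auto simp: matching_def)

lemma matching_couples_eq_iff:
  assumes "matching P \<mu>" "(m, w) \<in> \<mu>" "(m', w') \<in> \<mu>"
  shows "m = m' \<longleftrightarrow> w = w'"
  using assms matching_couple[OF assms(1,2)] unfolding matching_def by metis

lemma matching_subset_eq:
  assumes "matching P \<mu>" "matching P \<nu>" "\<mu> \<subseteq> \<nu>"
  shows "\<mu> = \<nu>"
proof
  show "\<nu> \<subseteq> \<mu>"
  proof
    fix c assume "c \<in> \<nu>"
    then obtain m w where c: "c = (m, w)" "(m, w) \<in> \<nu>" by (cases c) auto
    then obtain w' where w': "(m, w') \<in> \<mu>"
      using matching_ex_woman[OF assms(1)] matching_couple[OF assms(2)] by blast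
    then show "c \<in> \<mu>"
      using matching_couples_eq_iff[OF assms(2) c(2), of m w'] assms(3) c by auto
  qed
qed (fact assms(3))

text \<open>
  For the forward direction, a man and a woman of symbol \<open>j\<close> are available as witnesses of
  instability, because every symbol occurs in the column of any woman.
\<close>

lemma stable_rank_class_iff_left_to_right_minimum:
  assumes J: "joint_with_key n P f" and i: "i \<in> {1..n}"
  shows "stable_matching P (rank_class P i) \<longleftrightarrow> i \<in> left_to_right_minima n f"
proof
  assume stable: "stable_matching P (rank_class P i)"
  have "f i < f j" if j: "j \<in> {1..n}" "j < i" for j
  proof (rule ccontr)
    assume "\<not> f i < f j"
    moreover have "f i \<noteq> f j" using key_eq_iff[OF J i j(1)] j(2) by simp
    ultimately have fj: "f j < f i" by simp
    obtain w where w: "w \<in> women P" using card_women[OF J] i by fastforce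
    obtain m where m: "m \<in> men P" "wrank P w m = j" using ex_man_of_rank[OF J w j(1)] by auto
    obtain m' where m': "m' \<in> men P" "wrank P w m' = i" using ex_man_of_rank[OF J w i] by auto
    obtain w' where w': "w' \<in> women P" "wrank P w' m = i"
      using ex_woman_of_rank[OF J m(1) i] by auto
    have "blocking_pair P (rank_class P i) m w"
      unfolding blocking_pair_def
    proof (intro conjI exI)
      show "(m, w') \<in> rank_class P i" "(m', w) \<in> rank_class P i" "(m, w) \<notin> rank_class P i"
        using m m' w w' j by (auto simp: rank_class_def)
      show "mrank P m w < mrank P m w'"
        using mrank_eq_key_wrank[OF J m(1)] w w' m fj by simp
      show "wrank P w m < wrank P w m'" using m m' j by simp
    qed (use m w in auto)
    then show False using stable by (auto simp: stable_matching_def)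
  qed
  with i show "i \<in> left_to_right_minima n f" by (simp add: left_to_right_minima_def)
next
  assume min: "i \<in> left_to_right_minima n f"
  have "\<not> blocking_pair P (rank_class P i) m w" for m w
  proof
    assume "blocking_pair P (rank_class P i) m w"
    then obtain w' m' where m: "m \<in> men P" and w: "w \<in> women P"
      and mw': "(m, w') \<in> rank_class P i" "mrank P m w < mrank P m w'"
      and m'w: "(m', w) \<in> rank_class P i" "wrank P w m < wrank P w m'"
      by (auto simp: blocking_pair_def)
    have "wrank P w m < i" using m'w by (simp add: rank_class_def)
    moreover have "f (wrank P w m) < f i"
      using mw' mrank_eq_key_wrank[OF J m] w by (simp add: rank_class_def)
    ultimately show False
      using min wrank_range[OF J m w] by (auto simp: left_to_right_minima_def)
  qed
  then show "stable_matching P (rank_class P i)"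
    using matching_rank_class[OF J i] by (simp add: stable_matching_def)
qed

section \<open>Stable matchings of order three are uniform\<close>

text \<open>
  Let the couples with symbols \<open>a\<close> and \<open>b\<close> occupy the first two diagonal cells.  The other two
  cells of their rows and columns must then hold the third symbol \<open>c\<close>; so the first two cells of
  the third column hold \<open>b\<close> and \<open>a\<close>, which leaves \<open>c\<close> for the third couple.
\<close>

lemma nonuniform_three_matching_has_all_ranks:
  assumes J: "joint_with_key 3 P f" and M: "matching P \<mu>"
    and c1: "(m1, w1) \<in> \<mu>" and c2: "(m2, w2) \<in> \<mu>"
    and ne: "wrank P w1 m1 \<noteq> wrank P w2 m2"
    and i: "i \<in> {1..3}"
  shows "\<exists>m w. (m, w) \<in> \<mu> \<and> wrank P w m = i"
proof -
  have in12: "m1 \<in> men P" "w1 \<in> women P" "m2 \<in> men P" "w2 \<in> women P"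
    using matching_couple[OF M] c1 c2 by auto
  have d12: "m1 \<noteq> m2" "w1 \<noteq> w2"
    using matching_couples_eq_iff[OF M c1 c2] ne by auto
  have "card {m1, m2} < card (men P)" using card_men[OF J] d12 by simp
  then have "\<not> men P \<subseteq> {m1, m2}" by (meson card_mono finite.emptyI finite.insertI not_le)
  then obtain m3 where m3: "m3 \<in> men P" "m3 \<noteq> m1" "m3 \<noteq> m2" by auto
  then obtain w3 where c3: "(m3, w3) \<in> \<mu>" using matching_ex_woman[OF M] by blast
  have w3: "w3 \<in> women P" "w3 \<noteq> w1" "w3 \<noteq> w2"
    using matching_couple[OF M c3] matching_couples_eq_iff[OF M c3] c1 c2 m3 by auto
  have three: "{1..3} = {1, 2, 3::nat}" by auto
  let ?L = "\<lambda>m w. wrank P w m"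
  note row = wrank_inj_women[OF J] and col = wrank_inj_men[OF J]
  have rng: "?L m w = 1 \<or> ?L m w = 2 \<or> ?L m w = 3" if "m \<in> men P" "w \<in> women P" for m w
    using wrank_range[OF J that] unfolding three by simp
  have off12: "?L m1 w2 \<noteq> ?L m1 w1" "?L m1 w2 \<noteq> ?L m2 w2"
    "?L m2 w1 \<noteq> ?L m1 w1" "?L m2 w1 \<noteq> ?L m2 w2"
    using row col in12 d12 by metis+
  have off13: "?L m1 w3 \<noteq> ?L m1 w1" "?L m1 w3 \<noteq> ?L m1 w2"
    using row in12 w3 by metis+
  have off23: "?L m2 w3 \<noteq> ?L m2 w1" "?L m2 w3 \<noteq> ?L m2 w2"
    using row in12 w3 by metis+
  have off33: "?L m3 w3 \<noteq> ?L m1 w3" "?L m3 w3 \<noteq> ?L m2 w3"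
    using col in12 m3 w3 by metis+
  have "?L m1 w3 = ?L m2 w2"
    using off12(1,2) off13 ne rng[OF in12(1,2)] rng[OF in12(1,4)] rng[OF in12(3,4)]
      rng[OF in12(1) w3(1)] by metis
  moreover have "?L m2 w3 = ?L m1 w1"
    using off12(3,4) off23 ne rng[OF in12(1,2)] rng[OF in12(3,2)] rng[OF in12(3,4)]
      rng[OF in12(3) w3(1)] by metis
  moreover have "i = 1 \<or> i = 2 \<or> i = 3" using i unfolding three by simp
  ultimately have "i = ?L m1 w1 \<or> i = ?L m2 w2 \<or> i = ?L m3 w3"
    using off33 ne rng[OF in12(1,2)] rng[OF in12(3,4)] rng[OF m3(1) w3(1)] by metis
  with c1 c2 c3 show ?thesis by blast
qed

text \<open>
  The man of the couple with symbol \<open>a\<close> likes the pair of symbol \<open>c\<close> better than his own couple if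
  \<open>f c < f a\<close>, and the woman of the couple with symbol \<open>b\<close> does if \<open>c < b\<close>.  If \<open>f 1 < 3\<close>, take
  \<open>c = 1\<close> and \<open>a\<close> with \<open>f a = 3\<close>; if \<open>f 1 = 3\<close>, take \<open>a = 1\<close>, \<open>c = 2\<close> and \<open>b = 3\<close>.
\<close>

lemma stable_three_matching_ranks_eq:
  assumes J: "joint_with_key 3 P f" and S: "stable_matching P \<mu>"
    and c1: "(m1, w1) \<in> \<mu>" and c2: "(m2, w2) \<in> \<mu>"
  shows "wrank P w1 m1 = wrank P w2 m2"
proof (rule ccontr)
  assume ne: "wrank P w1 m1 \<noteq> wrank P w2 m2"
  have M: "matching P \<mu>" using S by (simp add: stable_matching_def)
  note all_ranks = nonuniform_three_matching_has_all_ranks[OF J M c1 c2 ne]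
  have no_block: "\<not> f c < f a" if abc: "{a, b, c} = {1..3}" "a \<noteq> b" "a \<noteq> c" "c < b" for a b c
  proof
    assume fc: "f c < f a"
    have "a \<in> {1..3}" "b \<in> {1..3}" using abc(1) by auto
    then obtain m w m' w' where mw: "(m, w) \<in> \<mu>" "wrank P w m = a"
      and mw': "(m', w') \<in> \<mu>" "wrank P w' m' = b" using all_ranks by blast
    have inP: "m \<in> men P" "w \<in> women P" "m' \<in> men P" "w' \<in> women P"
      using matching_couple[OF M] mw mw' by auto
    have d: "m \<noteq> m'" "w \<noteq> w'"
      using matching_couples_eq_iff[OF M mw(1) mw'(1)] mw(2) mw'(2) abc(2) by auto
    have "wrank P w' m \<noteq> a" "wrank P w' m \<noteq> b"
      using wrank_inj_women[OF J inP(1,2,4) d(2)] wrank_inj_men[OF J inP(4,1,3) d(1)] mw mw'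
      by auto
    then have c: "wrank P w' m = c"
      using wrank_range[OF J inP(1,4)] abc(1) by blast
    have "(m, w') \<notin> \<mu>" using matching_couples_eq_iff[OF M mw(1)] d by blast
    moreover have "mrank P m w' < mrank P m w"
      using mrank_eq_key_wrank[OF J inP(1)] inP mw c fc by simp
    moreover have "wrank P w' m < wrank P w' m'" using c mw' abc by simp
    ultimately have "blocking_pair P \<mu> m w'"
      using inP mw mw' by (auto simp: blocking_pair_def)
    then show False using S by (auto simp: stable_matching_def)
  qed
  have three: "{1..3} = {1, 2, 3::nat}" by auto
  have "\<not> f 1 < f 2" "\<not> f 1 < f 3" "\<not> f 2 < f 1"
    using no_block[of 2 3 1] no_block[of 3 2 1] no_block[of 1 3 2] unfolding three by auto
  moreover have "f 1 \<noteq> f 2" using key_eq_iff[OF J, of 1 2] by simp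
  ultimately show False by simp
qed

lemma stable_three_matching_is_rank_class:
  assumes J: "joint_with_key 3 P f" and S: "stable_matching P \<mu>"
  shows "\<exists>i\<in>{1..3}. \<mu> = rank_class P i"
proof -
  have M: "matching P \<mu>" using S by (simp add: stable_matching_def)
  obtain m where m: "m \<in> men P" using card_men[OF J] by fastforce
  then obtain w where mw: "(m, w) \<in> \<mu>" using M by (auto simp: matching_def)
  then have w: "w \<in> women P" using M by (auto simp: matching_def)
  let ?i = "wrank P w m"
  have i: "?i \<in> {1..3}" by (rule wrank_range[OF J m w])
  have "\<mu> \<subseteq> rank_class P ?i"
    using stable_three_matching_ranks_eq[OF J S _ mw] M
    by (auto simp: rank_class_def matching_def)
  then have "\<mu> = rank_class P ?i"
    by (rule matching_subset_eq[OF M matching_rank_class[OF J i]])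
  with i show ?thesis by blast
qed

lemma stable_three_matchings:
  assumes J: "joint_with_key 3 P f"
  shows "{\<nu>. stable_matching P \<nu>} = rank_class P ` left_to_right_minima 3 f"
proof -
  have "left_to_right_minima 3 f \<subseteq> {1..3}" by (auto simp: left_to_right_minima_def)
  then show ?thesis
    using stable_three_matching_is_rank_class[OF J]
      stable_rank_class_iff_left_to_right_minimum[OF J] by blast
qed

section \<open>Optimality\<close>

text \<open>
  A left-to-right minimum \<open>i\<close> satisfies \<open>f i \<le> f 1\<close>, so the couples of the first class, in which
  every woman has her first choice, are the worst for the men.
\<close>

lemma woman_optimal_first_rank_class:
  assumes J: "joint_with_key 3 P f"
  shows "woman_optimal P (rank_class P 1) \<and> man_pessimal P (rank_class P 1)"
proof -
  have stable: "stable_matching P (rank_class P 1)"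
    using stable_rank_class_iff_left_to_right_minimum[OF J, of 1]
    by (auto simp: left_to_right_minima_def)
  have "mrank P m w' \<le> mrank P m w"
    if mw: "(m, w) \<in> rank_class P 1" and valid: "valid_partners P m w'" for m w w'
  proof -
    obtain i where i: "i \<in> left_to_right_minima 3 f" "(m, w') \<in> rank_class P i"
      using valid stable_three_matchings[OF J] by (auto simp: valid_partners_def)
    have "1 < i \<longrightarrow> f i < f 1" "1 \<le> i" using i(1) by (simp_all add: left_to_right_minima_def)
    then have "f i \<le> f 1" by (cases "i = 1") auto
    then show ?thesis
      using mw i(2) mrank_eq_key_wrank[OF J] by (auto simp: rank_class_def)
  qed
  moreover have "1 \<le> wrank P w m" if "valid_partners P m w" for m w
    using that wrank_range[OF J]
    by (fastforce simp: valid_partners_def stable_matching_def matching_def)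
  ultimately show ?thesis
    using stable by (auto simp: woman_optimal_def man_pessimal_def rank_class_def)
qed

text \<open>
  No left-to-right minimum comes after the place \<open>k\<close> of the value \<open>1\<close>, so the couples of that class,
  in which every man has his first choice, are the worst for the women.
\<close>

lemma man_optimal_last_rank_class:
  assumes J: "joint_with_key 3 P f" and k: "k \<in> {1..3}" "f k = 1"
  shows "man_optimal P (rank_class P k) \<and> woman_pessimal P (rank_class P k)"
proof -
  have min: "k \<in> left_to_right_minima 3 f"
  proof -
    have "f k < f j" if "j \<in> {1..3}" "j < k" for j
      using key_range[OF J that(1)] key_eq_iff[OF J k(1) that(1)] that(2) k(2) by auto
    with k(1) show ?thesis by (simp add: left_to_right_minima_def)
  qed
  then have stable: "stable_matching P (rank_class P k)"
    using stable_rank_class_iff_left_to_right_minimum[OF J k(1)] by simp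
  have "wrank P w m' \<le> wrank P w m"
    if mw: "(m, w) \<in> rank_class P k" and valid: "valid_partners P m' w" for m w m'
  proof -
    obtain i where i: "i \<in> left_to_right_minima 3 f" "(m', w) \<in> rank_class P i"
      using valid stable_three_matchings[OF J] by (auto simp: valid_partners_def)
    have "i \<le> k"
    proof (rule ccontr)
      assume "\<not> i \<le> k"
      then have "f i < f k" using i(1) k(1) by (simp add: left_to_right_minima_def)
      moreover have "f i \<ge> 1"
        using i(1) key_range[OF J, of i] by (simp add: left_to_right_minima_def)
      ultimately show False using k(2) by simp
    qed
    then show ?thesis using mw i(2) by (simp add: rank_class_def)
  qed
  moreover have "1 \<le> mrank P m w" if "valid_partners P m w" for m w
    using that mrank_range[OF J]
    by (fastforce simp: valid_partners_def stable_matching_def matching_def)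
  moreover have "mrank P m w = 1" if "(m, w) \<in> rank_class P k" for m w
    using that mrank_eq_key_wrank[OF J] k by (auto simp: rank_class_def)
  ultimately show ?thesis
    using stable by (auto simp: man_optimal_def woman_pessimal_def)
qed

section \<open>The three kinds of keys\<close>

theorem mainTheorem4:
  fixes P :: "('m, 'w) profile" and f :: "nat \<Rightarrow> nat"
  assumes "joint_with_key 3 P f"
  shows "(\<forall>\<mu>. stable_matching P \<mu> \<longrightarrow> uniform_matching P \<mu>)
    \<and> (f 1 = 1 \<longrightarrow>
        (\<exists>\<mu>. uniform_matching_for P (1, 1) \<mu> \<and> {\<nu>. stable_matching P \<nu>} = {\<mu>}))
    \<and> ((\<forall>i\<in>{1..3}. f i = 4 - i) \<longrightarrow>
        (\<exists>\<mu>1 \<mu>2 \<mu>3. uniform_matching_for P (1, 3) \<mu>1 \<and> uniform_matching_for P (2, 2) \<mu>2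
           \<and> uniform_matching_for P (3, 1) \<mu>3 \<and> distinct [\<mu>1, \<mu>2, \<mu>3]
           \<and> {\<nu>. stable_matching P \<nu>} = {\<mu>1, \<mu>2, \<mu>3}))
    \<and> (f 1 \<noteq> 1 \<and> \<not> (\<forall>i\<in>{1..3}. f i = 4 - i) \<longrightarrow>
        (\<exists>\<mu>W \<mu>M. uniform_matching_for P (1, f 1) \<mu>W
           \<and> uniform_matching_for P (inv_into {1..3} f 1, 1) \<mu>M \<and> \<mu>W \<noteq> \<mu>M
           \<and> {\<nu>. stable_matching P \<nu>} = {\<mu>W, \<mu>M}
           \<and> woman_optimal P \<mu>W \<and> man_pessimal P \<mu>W
           \<and> man_optimal P \<mu>M \<and> woman_pessimal P \<mu>M))"
proof -
  note J = assms
  note stable = stable_three_matchings[OF J]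
  note uniform = uniform_rank_class[OF J]
  note inj = rank_class_inj[OF J]
  have three: "{1..3} = {1, 2, 3::nat}" by auto
  have key: "f 1 \<in> {1,2,3}" "f 2 \<in> {1,2,3}" "f 3 \<in> {1,2,3}" "f 1 \<noteq> f 2" "f 1 \<noteq> f 3" "f 2 \<noteq> f 3"
    using key_range[OF J] key_eq_iff[OF J] unfolding three by simp_all
  have minima: "i \<in> left_to_right_minima 3 f \<longleftrightarrow>
      i = 1 \<or> i = 2 \<and> f 2 < f 1 \<or> i = 3 \<and> f 3 < f 1 \<and> f 3 < f 2" for i
    unfolding left_to_right_minima_def three by auto
  show ?thesis
  proof (intro conjI impI)
    show "\<forall>\<mu>. stable_matching P \<mu> \<longrightarrow> uniform_matching P \<mu>"
      using stable_three_matching_is_rank_class[OF J] uniform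
      unfolding uniform_matching_def by blast
  next
    assume f1: "f 1 = 1"
    have "left_to_right_minima 3 f = {1}" using f1 key minima by auto
    then show "\<exists>\<mu>. uniform_matching_for P (1, 1) \<mu> \<and> {\<nu>. stable_matching P \<nu>} = {\<mu>}"
      using stable uniform[of 1] f1 by auto
  next
    assume "\<forall>i\<in>{1..3}. f i = 4 - i"
    then have f: "f 1 = 3" "f 2 = 2" "f 3 = 1" by auto
    have "left_to_right_minima 3 f = {1, 2, 3}" using f minima by auto
    then have "{\<nu>. stable_matching P \<nu>} = {rank_class P 1, rank_class P 2, rank_class P 3}"
      using stable by simp
    moreover have "distinct [rank_class P 1, rank_class P 2, rank_class P 3]"
      using inj unfolding three inj_on_def by simp
    ultimately show "\<exists>\<mu>1 \<mu>2 \<mu>3. uniform_matching_for P (1, 3) \<mu>1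
        \<and> uniform_matching_for P (2, 2) \<mu>2
        \<and> uniform_matching_for P (3, 1) \<mu>3 \<and> distinct [\<mu>1, \<mu>2, \<mu>3]
        \<and> {\<nu>. stable_matching P \<nu>} = {\<mu>1, \<mu>2, \<mu>3}"
      using uniform[of 1] uniform[of 2] uniform[of 3] f
      by - (rule exI[of _ "rank_class P 1"], rule exI[of _ "rank_class P 2"],
        rule exI[of _ "rank_class P 3"], simp)
  next
    assume "f 1 \<noteq> 1 \<and> \<not> (\<forall>i\<in>{1..3}. f i = 4 - i)"
    then have f1: "f 1 \<noteq> 1" and notrev: "\<not> (\<forall>i\<in>{1..3}. f i = 4 - i)" by blast+
    define k where "k = inv_into {1..3} f 1"
    have "1 \<in> f ` {1..3}" using key_bij[OF J] by (simp add: bij_betw_def)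
    then have k: "k \<in> {1..3}" "f k = 1"
      unfolding k_def by (rule inv_into_into, rule f_inv_into_f)
    have k1: "k \<noteq> 1" using k f1 by auto
    have not321: "\<not> (f 1 = 3 \<and> f 2 = 2 \<and> f 3 = 1)" using notrev unfolding three by auto
    consider "k = 2" | "k = 3" using k(1) k1 unfolding three by auto
    then have "left_to_right_minima 3 f = {1, k}"
    proof cases
      case 1
      then have "f 2 = 1" using k(2) by simp
      then have "f 2 < f 1" "\<not> f 3 < f 2" using key by auto
      then show ?thesis using minima 1 by auto
    next
      case 2
      then have f3: "f 3 = 1" using k(2) by simp
      then have "\<not> f 2 < f 1" "f 3 < f 1" "f 3 < f 2" using key not321 by auto
      then show ?thesis using minima 2 by auto
    qed
    then have "{\<nu>. stable_matching P \<nu>} = {rank_class P 1, rank_class P k}"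
      using stable by simp
    moreover have "rank_class P 1 \<noteq> rank_class P k"
      using inj_on_eq_iff[OF inj, of 1 k] k k1 by simp
    moreover have "uniform_matching_for P (1, f 1) (rank_class P 1)"
      "uniform_matching_for P (inv_into {1..3} f 1, 1) (rank_class P k)"
      using uniform[of 1] uniform[OF k(1)] unfolding k(2) k_def[symmetric] by simp_all
    ultimately show "\<exists>\<mu>W \<mu>M. uniform_matching_for P (1, f 1) \<mu>W
        \<and> uniform_matching_for P (inv_into {1..3} f 1, 1) \<mu>M \<and> \<mu>W \<noteq> \<mu>M
        \<and> {\<nu>. stable_matching P \<nu>} = {\<mu>W, \<mu>M}
        \<and> woman_optimal P \<mu>W \<and> man_pessimal P \<mu>W
        \<and> man_optimal P \<mu>M \<and> woman_pessimal P \<mu>M"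
      using woman_optimal_first_rank_class[OF J] man_optimal_last_rank_class[OF J k]
      by - (rule exI[of _ "rank_class P 1"], rule exI[of _ "rank_class P k"], iprover)
  qed
qed

end
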